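(* Let $V_{\mathbb H}^R$ be a separable right quaternionic Hilbert space and $A\in\mathcal B(V_{\mathbb H}^R)$. Then $$\sigma_S(A)=\sigma_e^S(A)\cup\bigcup_{k\in\mathbb Z}\sigma_k^S(A).$$
   Context: $\mathbb H$ denotes the quaternions. A right quaternionic Hilbert space is a right $\mathbb H$-vector space, complete for the norm of an $\mathbb H$-valued inner product $\langle\cdot|\cdot\rangle$ satisfying $\overline{\langle\phi|\psi\rangle}=\langle\psi|\phi\rangle$, $\|\phi\|^2=\langle\phi|\phi\rangle>0$ for $\phi\ne0$, additivity, $\langle\phi|\psi\mathfrak q\rangle=\langle\phi|\psi\rangle\mathfrak q$ and $\langle\phi\mathfrak q|\psi\rangle=\overline{\mathfrak q}\langle\phi|\psi\rangle$. $\mathcal B(V_{\mathbb H}^R)$ is the algebra of bounded right $\mathbb H$-linear operators on $V_{\mathbb H}^R$ and $\mathcal B_0(V_{\mathbb H}^R)$ is the closed two-sided ideal of compact operators (closure of the image of the closed unit ball is compact). For an element $a$ of a unital algebra with unit $1$ and $\mathfrak q\in\mathbb H$, put $R_{\mathfrak q}(a)=a^2-2\,\mathrm{Re}(\mathfrak q)a+|\mathfrak q|^2 1$; the $S$-spectrum $\sigma_S(a)$ is the set of $\mathfrak q\in\mathbb H$ for which $R_{\mathfrak q}(a)$ is not invertible in that algebra. $\sigma_S(A)$ is taken in $\mathcal B(V_{\mathbb H}^R)$. The essential $S$-spectrum is $\sigma_e^S(A)=\sigma_S(\pi(A))$ taken in the Calkin algebra $\mathcal B(V_{\mathbb H}^R)/\mathcal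 B_0(V_{\mathbb H}^R)$, where $\pi$ is the quotient map. $T\in\mathcal B(V_{\mathbb H}^R)$ is Fredholm, written $T\in\mathcal F(V_{\mathbb H}^R)$, if $\ker(T)$ and $V_{\mathbb H}^R/\mathrm{ran}(T)$ are finite dimensional over $\mathbb H$; then $\mathrm{ind}(T)=\dim\ker(T)-\dim(V_{\mathbb H}^R/\mathrm{ran}(T))$. For $k\in\mathbb Z\setminus\{0\}$, $\sigma_k^S(A)=\{\mathfrak q\in\mathbb H: R_{\mathfrak q}(A)\in\mathcal F(V_{\mathbb H}^R)\text{ and }\mathrm{ind}(R_{\mathfrak q}(A))=k\}$, and $\sigma_0^S(A)=\{\mathfrak q\in\sigma_S(A): R_{\mathfrak q}(A)\in\mathcal F(V_{\mathbb H}^R)\text{ and }\mathrm{ind}(R_{\mathfrak q}(A))=0\}$. *)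

theory Defs
  imports "HOL-Analysis.Analysis" "HOL-Algebra.QuotRing" "HOL-Algebra.Module"
begin

section \<open>Quaternions\<close>

datatype quat = Quat (qRe: real) (qI: real) (qJ: real) (qK: real)

lemma quat_eq_iff: "x = y \<longleftrightarrow> qRe x = qRe y \<and> qI x = qI y \<and> qJ x = qJ y \<and> qK x = qK y"
  by (cases x; cases y) auto

instantiation quat :: ab_group_add
begin

definition "0 = Quat 0 0 0 0"
definition "x + y = Quat (qRe x + qRe y) (qI x + qI y) (qJ x + qJ y) (qK x + qK y)"
definition "- x = Quat (- qRe x) (- qI x) (- qJ x) (- qK x)"
definition "x - y = Quat (qRe x - qRe y) (qI x - qI y) (qJ x - qJ y) (qK x - qK y)"

instance
  by standard (auto simp: zero_quat_def plus_quat_def uminus_quat_def minus_quat_def)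

end

instantiation quat :: real_div_algebra
begin

definition "1 = Quat 1 0 0 0"
definition "x * y = Quat
  (qRe x * qRe y - qI x * qI y - qJ x * qJ y - qK x * qK y)
  (qRe x * qI y + qI x * qRe y + qJ x * qK y - qK x * qJ y)
  (qRe x * qJ y - qI x * qK y + qJ x * qRe y + qK x * qI y)
  (qRe x * qK y + qI x * qJ y - qJ x * qI y + qK x * qRe y)"
definition "r *\<^sub>R x = Quat (r * qRe x) (r * qI x) (r * qJ x) (r * qK x)"
definition "inverse x = (let n = (qRe x)\<^sup>2 + (qI x)\<^sup>2 + (qJ x)\<^sup>2 + (qK x)\<^sup>2
  in Quat (qRe x / n) (- qI x / n) (- qJ x / n) (- qK x / n))"
definition "x div y = x * inverse (y :: quat)"

instance
proof
  fix x :: quat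
  assume "x \<noteq> 0"
  then have n: "(qRe x)\<^sup>2 + (qI x)\<^sup>2 + (qJ x)\<^sup>2 + (qK x)\<^sup>2 \<noteq> 0"
    by (auto simp: quat_eq_iff zero_quat_def add_nonneg_eq_0_iff)
  have "a * (a / n) + b * (b / n) + c * (c / n) + d * (d / n) = 1"
    if "a\<^sup>2 + b\<^sup>2 + c\<^sup>2 + d\<^sup>2 = n" "n \<noteq> 0" for a b c d n :: real
    using that by (simp add: divide_simps power2_eq_square)
  from this[OF refl n] show "inverse x * x = 1" "x * inverse x = 1"
    by (auto simp: quat_eq_iff inverse_quat_def Let_def times_quat_def one_quat_def algebra_simps)
qed (auto simp: quat_eq_iff zero_quat_def one_quat_def plus_quat_def times_quat_def
    scaleR_quat_def inverse_quat_def divide_quat_def algebra_simps)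

end

instantiation quat :: real_inner
begin

definition "inner x y = qRe x * qRe y + qI x * qI y + qJ x * qJ y + qK x * qK y"
definition "norm x = sqrt (inner x (x :: quat))"
definition "sgn x = x /\<^sub>R norm (x :: quat)"
definition "dist x y = norm (x - y :: quat)"
definition "(uniformity :: (quat \<times> quat) filter)
  = (INF e\<in>{0<..}. principal {(x, y). dist x y < e})"
definition "open (U :: quat set)
  \<longleftrightarrow> (\<forall>x\<in>U. eventually (\<lambda>(x', y). x' = x \<longrightarrow> y \<in> U) uniformity)"

instance
proof
  fix x y z :: quat and r :: real
  show "inner x x = 0 \<longleftrightarrow> x = 0"
    by (auto simp: quat_eq_iff inner_quat_def zero_quat_def add_nonneg_eq_0_iff)
qed (auto simp: inner_quat_def plus_quat_def scaleR_quat_def norm_quat_def sgn_quat_def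
    dist_quat_def uniformity_quat_def open_quat_def algebra_simps)

end

instance quat :: real_normed_div_algebra
proof
  fix x y :: quat
  have "(a * p - b * q - c * r - d * s)\<^sup>2 + (a * q + b * p + c * s - d * r)\<^sup>2
      + (a * r - b * s + c * p + d * q)\<^sup>2 + (a * s + b * r - c * q + d * p)\<^sup>2
    = (a\<^sup>2 + b\<^sup>2 + c\<^sup>2 + d\<^sup>2) * (p\<^sup>2 + q\<^sup>2 + r\<^sup>2 + s\<^sup>2)" for a b c d p q r s :: real
    by Groebner_Basis.algebra
  then have "inner (x * y) (x * y) = inner x x * inner y y"
    by (simp add: inner_quat_def times_quat_def flip: power2_eq_square)
  then show "norm (x * y) = norm x * norm y"
    by (simp add: norm_quat_def real_sqrt_mult)
qed

definition qcnj :: "quat \<Rightarrow> quat"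
  where "qcnj q = Quat (qRe q) (- qI q) (- qJ q) (- qK q)"


section \<open>Right quaternionic Hilbert spaces\<close>

text \<open>
  The underlying real normed space is the one obtained by restricting scalars to the reals and
  taking the norm of the inner product.
\<close>

class right_quaternionic_inner = real_normed_vector +
  fixes scaleH :: "'a \<Rightarrow> quat \<Rightarrow> 'a" (infixl \<open>*\<^sub>H\<close> 75)
    and qinner :: "'a \<Rightarrow> 'a \<Rightarrow> quat"
  assumes scaleH_add_left: "(x + y) *\<^sub>H q = x *\<^sub>H q + y *\<^sub>H q"
    and scaleH_add_right: "x *\<^sub>H (p + q) = x *\<^sub>H p + x *\<^sub>H q"
    and scaleH_scaleH: "x *\<^sub>H p *\<^sub>H q = x *\<^sub>H (p * q)"
    and scaleH_one: "x *\<^sub>H 1 = x"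
    and scaleH_of_real: "x *\<^sub>H of_real r = r *\<^sub>R x"
    and qcnj_qinner: "qcnj (qinner x y) = qinner y x"
    and qinner_add_right: "qinner x (y + z) = qinner x y + qinner x z"
    and qinner_scaleH_right: "qinner x (y *\<^sub>H q) = qinner x y * q"
    and qinner_scaleH_left: "qinner (x *\<^sub>H q) y = qcnj q * qinner x y"
    and qinner_self: "qinner x x = of_real ((norm x)\<^sup>2)"

class right_quaternionic_hilbert = right_quaternionic_inner + complete_space

lemma quat_bounded_linear:
  "bounded_linear qRe" "bounded_linear qI" "bounded_linear qJ" "bounded_linear qK"
  by (auto intro!: bounded_linear_intro[where K = 1] real_le_rsqrt
      simp: plus_quat_def scaleR_quat_def norm_quat_def inner_quat_def power2_eq_square)

instance quat :: complete_space
proof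
  fix X :: "nat \<Rightarrow> quat"
  assume X: "Cauchy X"
  have "convergent (\<lambda>n. f (X n))" if "bounded_linear f" for f :: "quat \<Rightarrow> real"
    using bounded_linear.Cauchy[OF that X] by (rule real_Cauchy_convergent)
  then obtain a b c d where
    lim: "(\<lambda>n. qRe (X n)) \<longlonglongrightarrow> a" "(\<lambda>n. qI (X n)) \<longlonglongrightarrow> b"
      "(\<lambda>n. qJ (X n)) \<longlonglongrightarrow> c" "(\<lambda>n. qK (X n)) \<longlonglongrightarrow> d"
    using quat_bounded_linear unfolding convergent_def by metis
  have eq: "q = qRe q *\<^sub>R 1 + qI q *\<^sub>R Quat 0 1 0 0 + qJ q *\<^sub>R Quat 0 0 1 0 + qK q *\<^sub>R Quat 0 0 0 1"
    for q by (simp add: quat_eq_iff plus_quat_def scaleR_quat_def one_quat_def)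
  have "(\<lambda>n. qRe (X n) *\<^sub>R 1 + qI (X n) *\<^sub>R Quat 0 1 0 0 + qJ (X n) *\<^sub>R Quat 0 0 1 0
      + qK (X n) *\<^sub>R Quat 0 0 0 1)
    \<longlonglongrightarrow> a *\<^sub>R 1 + b *\<^sub>R Quat 0 1 0 0 + c *\<^sub>R Quat 0 0 1 0 + d *\<^sub>R Quat 0 0 0 1"
    by (intro tendsto_intros lim)
  then show "convergent X"
    unfolding eq[symmetric] by (auto simp: convergent_def)
qed

instantiation quat :: right_quaternionic_hilbert
begin

definition "x *\<^sub>H q = x * (q :: quat)"
definition "qinner x y = qcnj x * (y :: quat)"

instance
proof
  fix x y :: quat and r :: real
  have of_real: "of_real s = Quat s 0 0 0" for s
    by (simp add: of_real_def scaleR_quat_def one_quat_def)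
  show "x *\<^sub>H of_real r = r *\<^sub>R x"
    by (simp add: scaleH_quat_def of_real times_quat_def scaleR_quat_def)
  show "qinner x x = of_real ((norm x)\<^sup>2)"
    unfolding of_real norm_quat_def
    by (simp add: qinner_quat_def qcnj_def times_quat_def inner_quat_def)
qed (auto simp: quat_eq_iff scaleH_quat_def qinner_quat_def qcnj_def times_quat_def plus_quat_def
    one_quat_def algebra_simps)

end


section \<open>Quotients, dimension and the S-spectrum\<close>

text \<open>
  Records of type \<open>(quat, 'v) module\<close> serve as right quaternionic vector spaces and records of type
  \<open>(real, 'b) module\<close> as real algebras. Only the record type is used: the locale \<open>module\<close> asks
  for commutative scalars. For a right vector space, \<open>q \<odot> v\<close> is \<open>v\<close> multiplied by \<open>q\<close> on the right,
  and the ring multiplication and unit of the record play no role. In \<open>FactModule\<close>, the scalar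
  multiple of a coset \<open>I +> x\<close> is \<open>I +> (r \<odot> x)\<close> as soon as \<open>I\<close> is closed under \<open>\<odot>\<close>.
\<close>

definition FactModule :: "('k, 'v, 'm) module_scheme \<Rightarrow> 'v set \<Rightarrow> ('k, 'v set) module"
  where "FactModule M I = ring.extend (M Quot I)
    (module.fields (\<lambda>r X. \<Union>x\<in>X. I +>\<^bsub>M\<^esub> (r \<odot>\<^bsub>M\<^esub> x)))"

definition lin_comb :: "(quat, 'v, 'm) module_scheme \<Rightarrow> ('v \<Rightarrow> quat) \<Rightarrow> 'v set \<Rightarrow> 'v"
  where "lin_comb M c S = finsum M (\<lambda>v. c v \<odot>\<^bsub>M\<^esub> v) S"

definition is_finite_basis :: "(quat, 'v, 'm) module_scheme \<Rightarrow> 'v set \<Rightarrow> bool"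
  where "is_finite_basis M S \<longleftrightarrow> finite S \<and> S \<subseteq> carrier M
    \<and> (\<forall>v\<in>carrier M. \<exists>c. v = lin_comb M c S)
    \<and> (\<forall>c. lin_comb M c S = \<zero>\<^bsub>M\<^esub> \<longrightarrow> (\<forall>v\<in>S. c v = 0))"

definition finite_dim :: "(quat, 'v, 'm) module_scheme \<Rightarrow> bool"
  where "finite_dim M \<longleftrightarrow> (\<exists>S. is_finite_basis M S)"

text \<open>\<open>qdim\<close> is meaningful only under \<open>finite_dim\<close>; it is unspecified otherwise.\<close>

definition qdim :: "(quat, 'v, 'm) module_scheme \<Rightarrow> nat"
  where "qdim M = card (SOME S. is_finite_basis M S)"

definition R_poly :: "(real, 'b, 'm) module_scheme \<Rightarrow> quat \<Rightarrow> 'b \<Rightarrow> 'b"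
  where "R_poly M q a =
    (a \<otimes>\<^bsub>M\<^esub> a \<ominus>\<^bsub>M\<^esub> (2 * qRe q) \<odot>\<^bsub>M\<^esub> a) \<oplus>\<^bsub>M\<^esub> (norm q)\<^sup>2 \<odot>\<^bsub>M\<^esub> \<one>\<^bsub>M\<^esub>"

definition S_spectrum :: "(real, 'b, 'm) module_scheme \<Rightarrow> 'b \<Rightarrow> quat set"
  where "S_spectrum M a = {q. R_poly M q a \<notin> Units M}"


section \<open>Bounded operators and the Calkin algebra\<close>

definition right_linear_ops :: "('a::right_quaternionic_hilbert \<Rightarrow>\<^sub>L 'a) set"
  where "right_linear_ops = {T. \<forall>x q. blinfun_apply T (x *\<^sub>H q) = blinfun_apply T x *\<^sub>H q}"

definition bounded_op_algebra :: "(real, 'a::right_quaternionic_hilbert \<Rightarrow>\<^sub>L 'a) module"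
  where "bounded_op_algebra = \<lparr>carrier = right_linear_ops, mult = (o\<^sub>L), one = id_blinfun,
    zero = 0, add = (+), smult = (*\<^sub>R)\<rparr>"

definition compact_ops :: "('a::right_quaternionic_hilbert \<Rightarrow>\<^sub>L 'a) set"
  where "compact_ops = {T \<in> right_linear_ops. compact (closure (T ` cball 0 1))}"

definition calkin_algebra :: "(real, ('a::right_quaternionic_hilbert \<Rightarrow>\<^sub>L 'a) set) module"
  where "calkin_algebra = FactModule bounded_op_algebra compact_ops"

definition calkin_proj :: "('a::right_quaternionic_hilbert \<Rightarrow>\<^sub>L 'a) \<Rightarrow> ('a \<Rightarrow>\<^sub>L 'a) set"
  where "calkin_proj T = compact_ops +>\<^bsub>bounded_op_algebra\<^esub> T"

definition essential_S_spectrum :: "('a::right_quaternionic_hilbert \<Rightarrow>\<^sub>L 'a) \<Rightarrow> quat set"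
  where "essential_S_spectrum A = S_spectrum calkin_algebra (calkin_proj A)"

lemma right_linear_ops_simps [simp]:
  fixes S T :: "'a::right_quaternionic_hilbert \<Rightarrow>\<^sub>L 'a"
  shows "(0 :: 'a \<Rightarrow>\<^sub>L 'a) \<in> right_linear_ops"
    and "(id_blinfun :: 'a \<Rightarrow>\<^sub>L 'a) \<in> right_linear_ops"
    and "S \<in> right_linear_ops \<Longrightarrow> T \<in> right_linear_ops \<Longrightarrow> S + T \<in> right_linear_ops"
    and "S \<in> right_linear_ops \<Longrightarrow> T \<in> right_linear_ops \<Longrightarrow> S o\<^sub>L T \<in> right_linear_ops"
    and "S \<in> right_linear_ops \<Longrightarrow> - S \<in> right_linear_ops"
    and "S \<in> right_linear_ops \<Longrightarrow> r *\<^sub>R S \<in> right_linear_ops"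
proof -
  have 0: "0 *\<^sub>H q = (0 :: 'a)" for q
    using scaleH_add_left[of 0 0 q] by simp
  have m: "- x *\<^sub>H q = - (x *\<^sub>H q)" for x :: 'a and q
    using scaleH_add_left[of x "- x" q] 0 by (simp add: minus_unique)
  have r: "(r *\<^sub>R x) *\<^sub>H q = r *\<^sub>R (x *\<^sub>H q)" for x :: 'a and q r
  proof -
    have "of_real r * q = q * of_real r"
      by (simp add: of_real_def)
    then show ?thesis
      by (metis scaleH_of_real scaleH_scaleH)
  qed
  show "(0 :: 'a \<Rightarrow>\<^sub>L 'a) \<in> right_linear_ops" "(id_blinfun :: 'a \<Rightarrow>\<^sub>L 'a) \<in> right_linear_ops"
    "S \<in> right_linear_ops \<Longrightarrow> T \<in> right_linear_ops \<Longrightarrow> S + T \<in> right_linear_ops"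
    "S \<in> right_linear_ops \<Longrightarrow> T \<in> right_linear_ops \<Longrightarrow> S o\<^sub>L T \<in> right_linear_ops"
    "S \<in> right_linear_ops \<Longrightarrow> - S \<in> right_linear_ops"
    "S \<in> right_linear_ops \<Longrightarrow> r *\<^sub>R S \<in> right_linear_ops"
    by (auto simp: right_linear_ops_def blinfun.bilinear_simps 0 m r scaleH_add_left)
qed

lemma ring_bounded_op_algebra:
  "ring (bounded_op_algebra :: (real, 'a::right_quaternionic_hilbert \<Rightarrow>\<^sub>L 'a) module)"
proof (rule ringI)
  show "abelian_group (bounded_op_algebra :: (real, 'a \<Rightarrow>\<^sub>L 'a) module)"
  proof (rule abelian_groupI)
    fix x :: "'a \<Rightarrow>\<^sub>L 'a"
    assume "x \<in> carrier bounded_op_algebra"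
    then show "\<exists>y\<in>carrier bounded_op_algebra. y \<oplus>\<^bsub>bounded_op_algebra\<^esub> x = \<zero>\<^bsub>bounded_op_algebra\<^esub>"
      by (intro bexI[of _ "- x"]) (auto simp: bounded_op_algebra_def)
  qed (auto simp: bounded_op_algebra_def algebra_simps)
qed (unfold_locales, auto simp: bounded_op_algebra_def blinfun.bilinear_simps intro!: blinfun_eqI)

lemma compact_closure_subset:
  "compact K \<Longrightarrow> S \<subseteq> K \<Longrightarrow> compact (closure S)" for S K :: "'a::metric_space set"
  using compact_Int_closed[of K "closure S"] closure_minimal[of S K]
  by (simp add: compact_imp_closed inf_absorb2)

lemma ideal_compact_ops:
  "ideal compact_ops (bounded_op_algebra :: (real, 'a::right_quaternionic_hilbert \<Rightarrow>\<^sub>L 'a) module)"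
proof (rule idealI)
  have add: "S + T \<in> compact_ops" if "S \<in> compact_ops" "T \<in> compact_ops" for S T :: "'a \<Rightarrow>\<^sub>L 'a"
  proof -
    have "compact {x + y |x y. x \<in> closure (S ` cball 0 1) \<and> y \<in> closure (T ` cball 0 1)}"
      using that by (intro compact_sums) (auto simp: compact_ops_def)
    moreover have "(S + T) ` cball 0 1
        \<subseteq> {x + y |x y. x \<in> closure (S ` cball 0 1) \<and> y \<in> closure (T ` cball 0 1)}"
    proof (intro image_subsetI CollectI exI conjI)
      fix x :: 'a
      assume x: "x \<in> cball 0 1"
      show "(S + T) x = S x + T x"
        by (rule blinfun.add_left)
      show "S x \<in> closure (S ` cball 0 1)" "T x \<in> closure (T ` cball 0 1)"
        using x by (rule subsetD[OF closure_subset imageI])+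
    qed
    ultimately show ?thesis
      using that compact_closure_subset by (auto simp: compact_ops_def)
  qed
  have comp_left: "S o\<^sub>L T \<in> compact_ops" if "S \<in> right_linear_ops" "T \<in> compact_ops"
    for S T :: "'a \<Rightarrow>\<^sub>L 'a"
  proof -
    have "compact (S ` closure (T ` cball 0 1))"
      using that by (intro compact_continuous_image continuous_intros) (auto simp: compact_ops_def)
    moreover have "(S o\<^sub>L T) ` cball 0 1 \<subseteq> S ` closure (T ` cball 0 1)"
      using closure_subset[of "T ` cball 0 1"] by (auto simp del: mem_cball)
    ultimately show ?thesis
      using that compact_closure_subset by (auto simp: compact_ops_def)
  qed
  have scale: "r *\<^sub>R T \<in> compact_ops" if "T \<in> compact_ops" for r and T :: "'a \<Rightarrow>\<^sub>L 'a"
  proof -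
    have "(r *\<^sub>R id_blinfun) o\<^sub>L T = r *\<^sub>R T"
      by (rule blinfun_eqI) (simp add: blinfun.scaleR_left)
    then show ?thesis
      using comp_left[of "r *\<^sub>R id_blinfun" T] that by simp
  qed
  have comp_right: "T o\<^sub>L S \<in> compact_ops" if "S \<in> right_linear_ops" "T \<in> compact_ops"
    for S T :: "'a \<Rightarrow>\<^sub>L 'a"
  proof -
    have K: "compact (closure (((norm S + 1) *\<^sub>R T) ` cball 0 1))"
      using scale that by (auto simp: compact_ops_def)
    have "T (S x) \<in> ((norm S + 1) *\<^sub>R T) ` cball 0 1" if "x \<in> cball 0 1" for x
    proof (rule image_eqI[of _ _ "S x /\<^sub>R (norm S + 1)"])
      have n: "norm S + 1 > 0"
        by (rule add_nonneg_pos) auto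
      then show "T (S x) = ((norm S + 1) *\<^sub>R T) (S x /\<^sub>R (norm S + 1))"
        by (simp add: blinfun.bilinear_simps)
      have "norm (S x) \<le> norm S * norm x"
        by (rule norm_blinfun)
      also have "\<dots> \<le> norm S * 1"
        using that by (intro mult_left_mono) auto
      finally show "S x /\<^sub>R (norm S + 1) \<in> cball 0 1"
        using n by (simp add: divide_simps)
    qed
    then have "(T o\<^sub>L S) ` cball 0 1 \<subseteq> closure (((norm S + 1) *\<^sub>R T) ` cball 0 1)"
      by (auto simp del: mem_cball intro!: subsetD[OF closure_subset])
    then show ?thesis
      using that compact_closure_subset[OF K] by (auto simp: compact_ops_def)
  qed
  have zero: "0 \<in> (compact_ops :: ('a \<Rightarrow>\<^sub>L 'a) set)"
    by (auto simp: compact_ops_def image_constant_conv)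
  show "ring (bounded_op_algebra :: (real, 'a \<Rightarrow>\<^sub>L 'a) module)"
    by (rule ring_bounded_op_algebra)
  then interpret ring "bounded_op_algebra :: (real, 'a \<Rightarrow>\<^sub>L 'a) module" .
  show "subgroup compact_ops (add_monoid (bounded_op_algebra :: (real, 'a \<Rightarrow>\<^sub>L 'a) module))"
  proof (rule add.subgroupI)
    show "compact_ops \<noteq> ({} :: ('a \<Rightarrow>\<^sub>L 'a) set)"
      using zero by blast
  next
    fix T :: "'a \<Rightarrow>\<^sub>L 'a"
    assume T: "T \<in> compact_ops"
    then have "\<ominus>\<^bsub>bounded_op_algebra\<^esub> T = - T"
      by (intro minus_equality) (auto simp: bounded_op_algebra_def compact_ops_def)
    with scale[OF T, of "-1"] show "\<ominus>\<^bsub>bounded_op_algebra\<^esub> T \<in> compact_ops"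
      by simp
  qed (use zero add in \<open>auto simp: bounded_op_algebra_def compact_ops_def\<close>)
  fix S T :: "'a \<Rightarrow>\<^sub>L 'a"
  assume "T \<in> compact_ops" "S \<in> carrier bounded_op_algebra"
  with comp_left comp_right
  show "S \<otimes>\<^bsub>bounded_op_algebra\<^esub> T \<in> compact_ops" "T \<otimes>\<^bsub>bounded_op_algebra\<^esub> S \<in> compact_ops"
    by (auto simp: bounded_op_algebra_def)
qed


section \<open>Fredholm operators and the parts of the S-spectrum\<close>

definition vector_module :: "(quat, 'a::right_quaternionic_hilbert) module"
  where "vector_module = \<lparr>carrier = UNIV, mult = undefined, one = undefined,
    zero = 0, add = (+), smult = (\<lambda>q x. x *\<^sub>H q)\<rparr>"

definition ker_module ::
    "('a::right_quaternionic_hilbert \<Rightarrow>\<^sub>L 'a) \<Rightarrow> (quat, 'a) module"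
  where "ker_module T = vector_module\<lparr>carrier := {x. T x = 0}\<rparr>"

definition coker_module ::
    "('a::right_quaternionic_hilbert \<Rightarrow>\<^sub>L 'a) \<Rightarrow> (quat, 'a set) module"
  where "coker_module T = FactModule vector_module (range T)"

definition fredholm :: "('a::right_quaternionic_hilbert \<Rightarrow>\<^sub>L 'a) set"
  where "fredholm =
    {T \<in> right_linear_ops. finite_dim (ker_module T) \<and> finite_dim (coker_module T)}"

definition fredholm_index :: "('a::right_quaternionic_hilbert \<Rightarrow>\<^sub>L 'a) \<Rightarrow> int"
  where "fredholm_index T = int (qdim (ker_module T)) - int (qdim (coker_module T))"

definition S_spectrum_part ::
    "int \<Rightarrow> ('a::right_quaternionic_hilbert \<Rightarrow>\<^sub>L 'a) \<Rightarrow> quat set"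
  where "S_spectrum_part k A =
    (if k = 0
     then {q \<in> S_spectrum bounded_op_algebra A. R_poly bounded_op_algebra q A \<in> fredholm
             \<and> fredholm_index (R_poly bounded_op_algebra q A) = 0}
     else {q. R_poly bounded_op_algebra q A \<in> fredholm
             \<and> fredholm_index (R_poly bounded_op_algebra q A) = k})"

end

theory Submission
  imports Defs
begin

text \<open>
  Write \<open>T = R\<^sub>q(A)\<close>. An invertible \<open>T\<close> is invertible modulo the compact operators and has zero
  kernel and cokernel, hence index \<open>0\<close>; this gives the inclusion from right to left, because the
  index \<open>0\<close> part is by definition contained in the S-spectrum. Conversely, let \<open>T\<close> fail to be
  invertible while its class in the Calkin algebra is invertible. Then \<open>T\<close> is Fredholm, so \<open>q\<close> lies
  in the part of the S-spectrum that belongs to the index of \<open>T\<close>, whatever this index is. All the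
  analysis is therefore in one half of Atkinson's theorem, \<open>fredholm_if_invertible_mod_compact\<close>:
  if \<open>S T - 1\<close> and \<open>T S - 1\<close> are compact, then \<open>T\<close> is Fredholm.

  The kernel of \<open>T\<close> is finite dimensional because \<open>S T - 1\<close> is minus the identity on it, so that
  its unit ball lies in a compact set; a compact set is covered by finitely many sets of diameter
  less than \<open>\<surd>2\<close>, each of which contains at most one vector of an orthonormal set. The cokernel is
  finite dimensional because the range of \<open>T\<close> contains that of \<open>1 + K\<close> with \<open>K = T S - 1\<close>. Choose a
  finite rank projection \<open>P\<close> for which \<open>K - P K\<close> has norm at most \<open>1/2\<close>; then \<open>1 + K - P K\<close> is
  surjective by Banach's fixed point theorem, so the range of \<open>P\<close> together with the range of \<open>1 + K\<close>
  spans the space.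
\<close>


section \<open>Right quaternionic subspaces and orthonormal sets\<close>

lemma scaleH_zero_left [simp]: "0 *\<^sub>H q = 0"
  using scaleH_add_left[of 0 0 q] by simp

lemma scaleH_zero_right [simp]: "x *\<^sub>H 0 = 0"
  using scaleH_add_right[of x 0 0] by simp

lemma scaleH_minus_right: "x *\<^sub>H (- q) = - (x *\<^sub>H q)"
  using scaleH_add_right[of x q "- q"] by (simp add: eq_neg_iff_add_eq_0 add.commute)

lemma scaleH_diff_right: "x *\<^sub>H (p - q) = x *\<^sub>H p - x *\<^sub>H q"
  using scaleH_add_right[of x p "- q"] by (simp add: scaleH_minus_right)

lemma scaleH_sum_left: "sum f S *\<^sub>H q = (\<Sum>s\<in>S. f s *\<^sub>H q)"
  by (induction S rule: infinite_finite_induct) (auto simp: scaleH_add_left)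

lemma qinner_zero_right [simp]: "qinner x 0 = 0"
  using qinner_add_right[of x 0 0] by simp

lemma qinner_minus_right: "qinner x (- y) = - qinner x y"
  using qinner_add_right[of x y "- y"] by (simp add: eq_neg_iff_add_eq_0 add.commute)

lemma qinner_diff_right: "qinner x (y - z) = qinner x y - qinner x z"
  using qinner_add_right[of x y "- z"] by (simp add: qinner_minus_right)

lemma qinner_sum_right: "qinner x (sum f S) = (\<Sum>s\<in>S. qinner x (f s))"
  by (induction S rule: infinite_finite_induct) (auto simp: qinner_add_right)

lemma qinner_eq_0_sym: "qinner x y = 0 \<Longrightarrow> qinner y x = 0"
  using qcnj_qinner[of x y] by (simp add: qcnj_def zero_quat_def)

lemma qinner_add_left: "qinner (x + y) z = qinner x z + qinner y z"
proof -
  have "qcnj (p + q) = qcnj p + qcnj q" for p q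
    by (simp add: qcnj_def plus_quat_def)
  then show ?thesis
    by (metis qcnj_qinner qinner_add_right)
qed

lemma norm_add_orthogonal:
  assumes "qinner x y = 0"
  shows "(norm (x + y))\<^sup>2 = (norm x)\<^sup>2 + (norm y)\<^sup>2"
proof -
  have "of_real ((norm (x + y))\<^sup>2) = qinner (x + y) (x + y)"
    by (simp only: qinner_self)
  also have "\<dots> = qinner x x + qinner y y"
    using assms qinner_eq_0_sym[OF assms] by (simp add: qinner_add_left qinner_add_right)
  also have "\<dots> = of_real ((norm x)\<^sup>2 + (norm y)\<^sup>2)"
    by (simp only: qinner_self of_real_add)
  finally show ?thesis
    by (simp only: of_real_eq_iff)
qed

definition right_subspace :: "'a::right_quaternionic_inner set \<Rightarrow> bool"
  where "right_subspace W \<longleftrightarrow>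
    0 \<in> W \<and> (\<forall>x\<in>W. \<forall>y\<in>W. x + y \<in> W) \<and> (\<forall>x\<in>W. \<forall>q. x *\<^sub>H q \<in> W)"

lemma right_subspaceD:
  assumes "right_subspace W"
  shows "0 \<in> W"
    and "x \<in> W \<Longrightarrow> y \<in> W \<Longrightarrow> x + y \<in> W"
    and "x \<in> W \<Longrightarrow> x *\<^sub>H q \<in> W"
    and "x \<in> W \<Longrightarrow> - x \<in> W"
    and "x \<in> W \<Longrightarrow> y \<in> W \<Longrightarrow> x - y \<in> W"
proof -
  show m: "- x \<in> W" if "x \<in> W" for x
    using assms that unfolding right_subspace_def by (metis scaleH_minus_right scaleH_one)
  show "x - y \<in> W" if "x \<in> W" "y \<in> W"
    using assms that(1) m[OF that(2)] unfolding right_subspace_def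
    by (metis diff_conv_add_uminus)
qed (use assms in \<open>auto simp: right_subspace_def\<close>)

lemma right_subspace_sum:
  "right_subspace W \<Longrightarrow> (\<And>s. s \<in> S \<Longrightarrow> f s \<in> W) \<Longrightarrow> sum f S \<in> W"
  by (induction S rule: infinite_finite_induct) (auto intro: right_subspaceD)

definition orthonormal :: "'a::right_quaternionic_inner set \<Rightarrow> bool"
  where "orthonormal E \<longleftrightarrow> (\<forall>x\<in>E. \<forall>y\<in>E. qinner x y = (if x = y then 1 else 0))"

text \<open>For a finite orthonormal \<open>E\<close> this is the orthogonal projection onto the span of \<open>E\<close>.\<close>

definition oproj :: "'a::right_quaternionic_inner set \<Rightarrow> 'a \<Rightarrow> 'a"
  where "oproj E v = (\<Sum>e\<in>E. e *\<^sub>H qinner e v)"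

lemma oproj_diff: "oproj E (x - y) = oproj E x - oproj E y"
  by (simp add: oproj_def qinner_diff_right scaleH_diff_right sum_subtractf)

lemma orthonormal_norm: "orthonormal E \<Longrightarrow> e \<in> E \<Longrightarrow> norm e = 1"
  using qinner_self[of e] by (simp add: orthonormal_def power2_eq_1_iff flip: of_real_power)
    (metis abs_norm_cancel abs_minus_cancel abs_one)

lemma qinner_orthonormal_sum:
  assumes "orthonormal E" "finite E" "e \<in> E"
  shows "qinner e (\<Sum>x\<in>E. x *\<^sub>H c x) = c e"
proof -
  have "qinner e (\<Sum>x\<in>E. x *\<^sub>H c x) = (\<Sum>x\<in>E. if x = e then c e else 0)"
    unfolding qinner_sum_right qinner_scaleH_right
    using assms by (intro sum.cong) (auto simp: orthonormal_def)
  also have "\<dots> = c e"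
    using assms by simp
  finally show ?thesis .
qed

lemma qinner_oproj_residual:
  "orthonormal E \<Longrightarrow> finite E \<Longrightarrow> e \<in> E \<Longrightarrow> qinner e (v - oproj E v) = 0"
  by (simp add: qinner_diff_right oproj_def qinner_orthonormal_sum)

lemma qinner_oproj_eq_0: "(\<And>e. e \<in> E \<Longrightarrow> qinner e x = 0) \<Longrightarrow> qinner x (oproj E v) = 0"
  unfolding oproj_def qinner_sum_right qinner_scaleH_right
  by (simp add: qinner_eq_0_sym)

lemma norm_oproj_residual_le:
  assumes "orthonormal E" "finite E"
  shows "norm (v - oproj E v) \<le> norm v"
proof -
  have "qinner (v - oproj E v) (oproj E v) = 0"
    using assms by (intro qinner_oproj_eq_0 qinner_oproj_residual)
  from norm_add_orthogonal[OF this] have "(norm v)\<^sup>2 = (norm (v - oproj E v))\<^sup>2 + (norm (oproj E v))\<^sup>2"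
    by simp
  then have "(norm (v - oproj E v))\<^sup>2 \<le> (norm v)\<^sup>2"
    by simp
  then show ?thesis
    by (rule power2_le_imp_le) simp
qed

text \<open>
  One step of the Gram--Schmidt process: the new vector is the normalised residual of \<open>v\<close>. It is
  used both to extend an orthonormal set inside a subspace and to make a finite set of vectors
  orthonormal, so the conclusion records both the membership in \<open>U\<close> and the recovery of \<open>v\<close>.
\<close>

lemma gram_schmidt_step:
  assumes E: "orthonormal E" "finite E" and v: "oproj E v \<noteq> v"
    and U: "right_subspace U" "E \<subseteq> U" "v \<in> U"
  obtains e where "e \<in> U" "e \<notin> E" "orthonormal (insert e E)" "oproj (insert e E) v = v"
    "\<And>x. x \<in> E \<Longrightarrow> qinner x e = 0"
proof -
  define r where "r = v - oproj E v"
  define e where "e = r *\<^sub>H of_real (inverse (norm r))"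
  have r: "norm r \<noteq> 0"
    using v by (simp add: r_def)
  have e_r: "e *\<^sub>H of_real (norm r) = r"
    using r by (simp add: e_def scaleH_scaleH scaleH_one flip: of_real_mult)
  have orth: "qinner x e = 0" "qinner e x = 0" if "x \<in> E" for x
  proof -
    show "qinner x e = 0"
      using qinner_oproj_residual[OF E that, of v] by (simp add: e_def r_def qinner_scaleH_right)
    then show "qinner e x = 0"
      by (rule qinner_eq_0_sym)
  qed
  have "norm e = 1"
    using r by (simp add: e_def scaleH_of_real del: of_real_inverse)
  then have ee: "qinner e e = 1"
    by (simp add: qinner_self)
  have "e \<notin> E"
    using orth ee by force
  moreover have "orthonormal (insert e E)"
    using E(1) orth ee by (auto simp: orthonormal_def)
  moreover have "oproj (insert e E) v = v"
  proof -
    have "qinner e v = qinner e (oproj E v) + qinner e r"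
      by (simp add: r_def flip: qinner_add_right)
    also have "qinner e (oproj E v) = 0"
      by (rule qinner_oproj_eq_0) (rule orth)
    also have "qinner e r = qinner e (e *\<^sub>H of_real (norm r))"
      by (simp only: e_r)
    also have "\<dots> = of_real (norm r)"
      by (simp add: qinner_scaleH_right ee)
    finally have "e *\<^sub>H qinner e v = r"
      using e_r by simp
    then show ?thesis
      using \<open>e \<notin> E\<close> E(2) by (simp add: oproj_def) (simp add: r_def oproj_def)
  qed
  moreover have "e \<in> U"
    unfolding e_def r_def oproj_def using U
    by (intro right_subspaceD[OF U(1)] right_subspace_sum) auto
  ultimately show ?thesis
    using that orth by blast
qed

lemma finite_set_in_orthonormal_span:
  assumes "finite Y"
  shows "\<exists>E. orthonormal E \<and> finite E \<and> (\<forall>y\<in>Y. oproj E y = y)"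
  using assms
proof induction
  case empty
  then show ?case
    by (intro exI[of _ "{}"]) (simp add: orthonormal_def)
next
  case (insert y Y)
  then obtain E where E: "orthonormal E" "finite E" and Y: "\<forall>z\<in>Y. oproj E z = z"
    by blast
  show ?case
  proof (cases "oproj E y = y")
    case True
    then show ?thesis
      using E Y by blast
  next
    case False
    obtain e where e: "e \<notin> E" "orthonormal (insert e E)" "oproj (insert e E) y = y"
      "\<And>x. x \<in> E \<Longrightarrow> qinner x e = 0"
      using gram_schmidt_step[OF E False, of UNIV] by (auto simp: right_subspace_def)
    have "oproj (insert e E) z = z" if "z \<in> Y" for z
    proof -
      have "qinner e z = 0"
        using qinner_oproj_eq_0[of E e z] e(4) Y that by simp
      then show ?thesis
        using e(1) E(2) Y that by (simp add: oproj_def)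
    qed
    then show ?thesis
      using e E(2) by blast
  qed
qed

text \<open>
  Distinct orthonormal vectors have distance \<open>\<surd>2\<close>, so each ball of radius \<open>1/2\<close> of a finite cover
  of \<open>C\<close> contains at most one of them. This bounds the size of orthonormal sets in \<open>U\<close>, and an
  orthonormal set of maximal size spans \<open>U\<close>, as otherwise a Gram--Schmidt step would enlarge it.
\<close>

lemma finite_orthonormal_basis_if_compact_ball:
  assumes U: "right_subspace U" and C: "compact C" "U \<inter> cball 0 1 \<subseteq> C"
  obtains E where "orthonormal E" "finite E" "E \<subseteq> U" "\<And>v. v \<in> U \<Longrightarrow> oproj E v = v"
proof -
  obtain k where k: "finite k" "C \<subseteq> (\<Union>x\<in>k. ball x (1/2))"
    using C(1) unfolding compact_eq_totally_bounded by (meson half_gt_zero_iff zero_less_one)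
  define P where "P E \<longleftrightarrow> orthonormal E \<and> finite E \<and> E \<subseteq> U" for E
  have bound: "card E \<le> card k" if "P E" for E
  proof -
    have E: "orthonormal E" "E \<subseteq> U"
      using that by (auto simp: P_def)
    have "\<exists>z\<in>k. x \<in> ball z (1/2)" if "x \<in> E" for x
      using k(2) C(2) E orthonormal_norm[OF E(1) that] that by force
    then obtain g where g: "\<And>x. x \<in> E \<Longrightarrow> g x \<in> k" "\<And>x. x \<in> E \<Longrightarrow> x \<in> ball (g x) (1/2)"
      by metis
    have "inj_on g E"
    proof (rule inj_onI, rule ccontr)
      fix x y assume xy: "x \<in> E" "y \<in> E" "g x = g y" "x \<noteq> y"
      have "dist x y < 1"
        using g(2)[OF xy(1)] g(2)[OF xy(2)] xy(3) dist_triangle_half_r[of "g x" x 1 y] by simp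
      then have "(norm (x - y))\<^sup>2 < 1"
        by (simp add: dist_norm power_less_one_iff)
      moreover have "qinner x (- y) = 0"
        using E(1) xy by (auto simp: qinner_minus_right orthonormal_def)
      from norm_add_orthogonal[OF this] have "(norm (x - y))\<^sup>2 = 2"
        using orthonormal_norm[OF E(1)] xy by simp
      ultimately show False
        by simp
    qed
    then show ?thesis
      using g(1) k(1) by (intro card_inj_on_le) auto
  qed
  have "P {}"
    by (simp add: P_def orthonormal_def)
  then obtain E where E: "P E" "\<And>E'. P E' \<Longrightarrow> card E' \<le> card E"
    using ex_has_greatest_nat[of P "{}" card "Suc (card k)"] bound by (auto simp: less_Suc_eq_le)
  have "oproj E v = v" if v: "v \<in> U" for v
  proof (rule ccontr)
    assume "oproj E v \<noteq> v"
    then obtain e where "e \<in> U" "e \<notin> E" "orthonormal (insert e E)"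
      using gram_schmidt_step[of E v U] E(1) U v unfolding P_def by metis
    then show False
      using E(2)[of "insert e E"] E(1) by (simp add: P_def)
  qed
  then show ?thesis
    using that E(1) by (auto simp: P_def)
qed


section \<open>Cosets and bases of quotients\<close>

text \<open>
  The next two lemmas concern records whose addition is that of the underlying type, so that they
  apply to quotients of the space and to the Calkin algebra alike.
\<close>

lemma coset_eq_iff:
  fixes W :: "'v::ab_group_add set"
  assumes M: "add M = (+)"
    and W: "0 \<in> W" "\<And>x y. x \<in> W \<Longrightarrow> y \<in> W \<Longrightarrow> x + y \<in> W" "\<And>x. x \<in> W \<Longrightarrow> - x \<in> W"
  shows "W +>\<^bsub>M\<^esub> x = W +>\<^bsub>M\<^esub> y \<longleftrightarrow> x - y \<in> W"
proof -
  have mem: "z \<in> W +>\<^bsub>M\<^esub> x \<longleftrightarrow> z - x \<in> W" for z x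
    by (auto simp: a_r_coset_def' M intro: bexI[of _ "z - x"])
  show ?thesis
  proof
    assume "W +>\<^bsub>M\<^esub> x = W +>\<^bsub>M\<^esub> y"
    moreover have "x \<in> W +>\<^bsub>M\<^esub> x"
      using W(1) by (simp add: mem)
    ultimately have "x \<in> W +>\<^bsub>M\<^esub> y"
      by simp
    then show "x - y \<in> W"
      by (simp only: mem)
  next
    assume xy: "x - y \<in> W"
    have "z - x \<in> W \<longleftrightarrow> z - y \<in> W" for z
      using W(2)[OF _ xy, of "z - x"] W(2)[OF _ W(3)[OF xy], of "z - y"] by auto
    then show "W +>\<^bsub>M\<^esub> x = W +>\<^bsub>M\<^esub> y"
      by (auto simp only: set_eq_iff mem)
  qed
qed

lemma FactModule_smult_coset:
  fixes W :: "'v::ab_group_add set"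
  assumes M: "add M = (+)" "\<And>x y. r \<odot>\<^bsub>M\<^esub> (x + y) = r \<odot>\<^bsub>M\<^esub> x + r \<odot>\<^bsub>M\<^esub> y"
    and W: "0 \<in> W" "\<And>x y. x \<in> W \<Longrightarrow> y \<in> W \<Longrightarrow> x + y \<in> W" "\<And>x. x \<in> W \<Longrightarrow> - x \<in> W"
      "\<And>x. x \<in> W \<Longrightarrow> r \<odot>\<^bsub>M\<^esub> x \<in> W"
  shows "r \<odot>\<^bsub>FactModule M W\<^esub> (W +>\<^bsub>M\<^esub> x) = W +>\<^bsub>M\<^esub> (r \<odot>\<^bsub>M\<^esub> x)"
proof -
  have "W +>\<^bsub>M\<^esub> (r \<odot>\<^bsub>M\<^esub> y) = W +>\<^bsub>M\<^esub> (r \<odot>\<^bsub>M\<^esub> x)" if y: "y \<in> W +>\<^bsub>M\<^esub> x" for y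
  proof -
    obtain w where "w \<in> W" "y = w + x"
      using y by (auto simp: a_r_coset_def' M(1))
    then have "r \<odot>\<^bsub>M\<^esub> y - r \<odot>\<^bsub>M\<^esub> x \<in> W"
      by (simp add: M(2) W(4))
    then show ?thesis
      by (simp only: coset_eq_iff[OF M(1) W(1-3)])
  qed
  moreover have "x \<in> W +>\<^bsub>M\<^esub> x"
    using W(1) by (simp add: a_r_coset_def' M(1) bexI[of _ 0])
  ultimately have "(\<Union>y\<in>W +>\<^bsub>M\<^esub> x. W +>\<^bsub>M\<^esub> (r \<odot>\<^bsub>M\<^esub> y)) = W +>\<^bsub>M\<^esub> (r \<odot>\<^bsub>M\<^esub> x)"
    by blast
  then show ?thesis
    by (simp add: FactModule_def ring.defs module.defs)
qed

context
  fixes W :: "'a::right_quaternionic_hilbert set"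
  assumes W: "right_subspace W"
begin

abbreviation vcoset :: "'a \<Rightarrow> 'a set"
  where "vcoset x \<equiv> W +>\<^bsub>vector_module\<^esub> x"

lemma vcoset_eq_iff: "vcoset x = vcoset y \<longleftrightarrow> x - y \<in> W"
  by (rule coset_eq_iff) (simp add: vector_module_def, (fact right_subspaceD[OF W])+)

lemma vcoset_zero: "vcoset 0 = W"
  by (auto simp: a_r_coset_def' vector_module_def)

lemma FactModule_vector_module_simps:
  "carrier (FactModule vector_module W) = range vcoset"
  "\<zero>\<^bsub>FactModule vector_module W\<^esub> = W"
  "vcoset x \<oplus>\<^bsub>FactModule vector_module W\<^esub> vcoset y = vcoset (x + y)"
  "q \<odot>\<^bsub>FactModule vector_module W\<^esub> vcoset x = vcoset (x *\<^sub>H q)"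
proof -
  show "carrier (FactModule vector_module W) = range vcoset"
  proof -
    have "carrier vector_module = (UNIV :: 'a set)"
      by (simp add: vector_module_def)
    then show ?thesis
      by (auto simp: FactModule_def ring.defs module.defs FactRing_def A_RCOSETS_def')
  qed
  show "\<zero>\<^bsub>FactModule vector_module W\<^esub> = W"
    by (simp add: FactModule_def ring.defs module.defs FactRing_def)
  have "vcoset x <+>\<^bsub>vector_module\<^esub> vcoset y = vcoset (x + y)"
  proof (intro equalityI subsetI)
    fix z assume "z \<in> vcoset x <+>\<^bsub>vector_module\<^esub> vcoset y"
    then obtain a b where ab: "a \<in> W" "b \<in> W" "z = (a + x) + (b + y)"
      by (auto simp: set_add_def' a_r_coset_def' vector_module_def)
    then have "z = (a + b) + (x + y)" "a + b \<in> W"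
      by (auto intro: right_subspaceD[OF W])
    then show "z \<in> vcoset (x + y)"
      by (auto simp: a_r_coset_def' vector_module_def)
  next
    fix z assume "z \<in> vcoset (x + y)"
    then obtain a where a: "a \<in> W" "z = (a + x) + (0 + y)"
      by (auto simp: a_r_coset_def' vector_module_def add.assoc)
    then have "a + x \<in> vcoset x" "0 + y \<in> vcoset y"
      using right_subspaceD(1)[OF W] unfolding a_r_coset_def' by (auto simp: vector_module_def)
    then show "z \<in> vcoset x <+>\<^bsub>vector_module\<^esub> vcoset y"
      unfolding set_add_def' a(2) by (force simp: vector_module_def)
  qed
  then show "vcoset x \<oplus>\<^bsub>FactModule vector_module W\<^esub> vcoset y = vcoset (x + y)"
    by (simp add: FactModule_def ring.defs module.defs FactRing_def)
  have "q \<odot>\<^bsub>FactModule vector_module W\<^esub> vcoset x = vcoset (q \<odot>\<^bsub>vector_module\<^esub> x)"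
    by (rule FactModule_smult_coset)
      (auto simp: vector_module_def scaleH_add_left intro: right_subspaceD[OF W])
  then show "q \<odot>\<^bsub>FactModule vector_module W\<^esub> vcoset x = vcoset (x *\<^sub>H q)"
    by (simp add: vector_module_def)
qed

lemma abelian_monoid_FactModule: "abelian_monoid (FactModule vector_module W)"
proof (rule abelian_monoidI)
  show "\<zero>\<^bsub>FactModule vector_module W\<^esub> \<in> carrier (FactModule vector_module W)"
    unfolding FactModule_vector_module_simps by (metis vcoset_zero rangeI)
  fix X assume "X \<in> carrier (FactModule vector_module W)"
  then obtain x where "X = vcoset x"
    by (auto simp: FactModule_vector_module_simps)
  then show "\<zero>\<^bsub>FactModule vector_module W\<^esub> \<oplus>\<^bsub>FactModule vector_module W\<^esub> X = X"
    using FactModule_vector_module_simps(3)[of 0 x]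
    by (simp add: vcoset_zero FactModule_vector_module_simps(2))
qed (auto simp: FactModule_vector_module_simps algebra_simps)

lemma lin_comb_vcoset:
  assumes "finite S" "inj_on vcoset S"
  shows "lin_comb (FactModule vector_module W) c (vcoset ` S) = vcoset (\<Sum>s\<in>S. s *\<^sub>H c (vcoset s))"
  using assms
proof induction
  case empty
  interpret abelian_monoid "FactModule vector_module W"
    by (rule abelian_monoid_FactModule)
  show ?case
    by (simp add: lin_comb_def vcoset_zero FactModule_vector_module_simps(2))
next
  case (insert s S)
  interpret abelian_monoid "FactModule vector_module W"
    by (rule abelian_monoid_FactModule)
  have "vcoset s \<notin> vcoset ` S" "inj_on vcoset S"
    using insert by auto
  then show ?case
    using insert unfolding lin_comb_def image_insert
    by (subst finsum_insert) (auto simp: FactModule_vector_module_simps)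
qed

text \<open>
  A finite set that spans modulo \<open>W\<close> and has the least possible size is independent modulo \<open>W\<close>: a
  vector with a nonzero coefficient in a relation could be eliminated. In particular, its elements
  lie in distinct cosets, and these cosets form a basis of the quotient.
\<close>

lemma finite_dim_quotient_if_finite_span:
  assumes "finite E" "\<And>v. \<exists>c. v - (\<Sum>s\<in>E. s *\<^sub>H c s) \<in> W"
  shows "finite_dim (FactModule vector_module W)"
proof -
  define spans where "spans S \<longleftrightarrow> finite S \<and> (\<forall>v. \<exists>c. v - (\<Sum>s\<in>S. s *\<^sub>H c s) \<in> W)" for S
  have "spans E"
    using assms by (simp add: spans_def)
  then obtain S where S: "spans S" and least: "\<And>S'. spans S' \<Longrightarrow> card S \<le> card S'"
    using ex_has_least_nat[of spans E card] by blast
  have fin: "finite S"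
    using S by (simp add: spans_def)
  have indep: "c t = 0" if c: "(\<Sum>s\<in>S. s *\<^sub>H c s) \<in> W" and t: "t \<in> S" for c t
  proof (rule ccontr)
    assume nz: "c t \<noteq> 0"
    have "\<exists>d. v - (\<Sum>s\<in>S - {t}. s *\<^sub>H d s) \<in> W" for v
    proof -
      obtain d where d: "v - (\<Sum>s\<in>S. s *\<^sub>H d s) \<in> W"
        using S by (auto simp: spans_def)
      \<comment> \<open>Subtract the multiple of the relation \<open>c\<close> that makes the coefficient of \<open>t\<close> vanish.\<close>
      define b where "b = inverse (c t) * d t"
      define d' where "d' s = d s - c s * b" for s
      have "d' t = 0"
        using nz by (simp add: d'_def b_def flip: mult.assoc)
      then have "v - (\<Sum>s\<in>S - {t}. s *\<^sub>H d' s) = v - (\<Sum>s\<in>S. s *\<^sub>H d' s)"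
        using fin t by (simp add: sum.remove)
      also have "\<dots> = (v - (\<Sum>s\<in>S. s *\<^sub>H d s)) + (\<Sum>s\<in>S. s *\<^sub>H c s) *\<^sub>H b"
        by (simp add: d'_def scaleH_diff_right sum_subtractf scaleH_sum_left scaleH_scaleH)
      also have "\<dots> \<in> W"
        by (intro right_subspaceD[OF W] c d)
      finally show ?thesis
        by blast
    qed
    then have "spans (S - {t})"
      using fin by (simp add: spans_def)
    then have "card S \<le> card (S - {t})"
      by (rule least)
    moreover have "card (S - {t}) < card S"
      using fin t by (rule card_Diff1_less)
    ultimately show False
      by simp
  qed
  have inj: "inj_on vcoset S"
  proof (rule inj_onI, rule ccontr)
    fix s t assume st: "s \<in> S" "t \<in> S" "vcoset s = vcoset t" "s \<noteq> t"
    define c where "c x = (if x = s then 1 else if x = t then - 1 else 0 :: quat)" for x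
    have "(\<Sum>x\<in>S. x *\<^sub>H c x) = (\<Sum>x\<in>{s, t}. x *\<^sub>H c x)"
      using fin st by (intro sum.mono_neutral_right) (auto simp: c_def)
    also have "\<dots> = s - t"
      using st(4) by (simp add: c_def scaleH_one scaleH_minus_right)
    finally have "c s = 0"
      using st by (intro indep) (auto simp: vcoset_eq_iff)
    then show False
      by (simp add: c_def)
  qed
  have "is_finite_basis (FactModule vector_module W) (vcoset ` S)"
    unfolding is_finite_basis_def
  proof (intro conjI ballI allI impI)
    show "finite (vcoset ` S)" "vcoset ` S \<subseteq> carrier (FactModule vector_module W)"
      using fin by (auto simp: FactModule_vector_module_simps)
  next
    fix X assume "X \<in> carrier (FactModule vector_module W)"
    then obtain v where v: "X = vcoset v"
      by (auto simp: FactModule_vector_module_simps)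
    obtain d where d: "v - (\<Sum>s\<in>S. s *\<^sub>H d s) \<in> W"
      using S by (auto simp: spans_def)
    have "X = lin_comb (FactModule vector_module W) (\<lambda>Y. d (the_inv_into S vcoset Y)) (vcoset ` S)"
      using d inj unfolding lin_comb_vcoset[OF fin inj] v vcoset_eq_iff
      by (simp add: the_inv_into_f_f)
    then show "\<exists>c. X = lin_comb (FactModule vector_module W) c (vcoset ` S)"
      by blast
  next
    fix c X
    assume c: "lin_comb (FactModule vector_module W) c (vcoset ` S) = \<zero>\<^bsub>FactModule vector_module W\<^esub>"
      and "X \<in> vcoset ` S"
    then obtain s where s: "s \<in> S" "X = vcoset s"
      by blast
    have "vcoset (\<Sum>s\<in>S. s *\<^sub>H c (vcoset s)) = vcoset 0"
      using c unfolding lin_comb_vcoset[OF fin inj] FactModule_vector_module_simps vcoset_zero .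
    then have "(\<Sum>s\<in>S. s *\<^sub>H c (vcoset s)) \<in> W"
      by (simp add: vcoset_eq_iff)
    from indep[OF this s(1)] show "c X = 0"
      by (simp add: s)
  qed
  then show ?thesis
    by (auto simp: finite_dim_def)
qed

lemma abelian_monoid_subspace: "abelian_monoid (vector_module\<lparr>carrier := W\<rparr>)"
  by (rule abelian_monoidI) (auto simp: vector_module_def right_subspaceD[OF W] algebra_simps)

lemma lin_comb_subspace:
  assumes "finite S" "S \<subseteq> W"
  shows "lin_comb (vector_module\<lparr>carrier := W\<rparr>) c S = (\<Sum>s\<in>S. s *\<^sub>H c s)"
  using assms
proof induction
  case empty
  interpret abelian_monoid "vector_module\<lparr>carrier := W\<rparr>"
    by (rule abelian_monoid_subspace)
  show ?case
    using finsum_empty by (simp add: lin_comb_def) (simp add: vector_module_def)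
next
  case (insert s S)
  interpret abelian_monoid "vector_module\<lparr>carrier := W\<rparr>"
    by (rule abelian_monoid_subspace)
  show ?case
    using insert unfolding lin_comb_def
    by (subst finsum_insert) (auto simp: vector_module_def right_subspaceD[OF W])
qed

lemma finite_dim_subspace_if_compact_ball:
  assumes "compact C" "W \<inter> cball 0 1 \<subseteq> C"
  shows "finite_dim (vector_module\<lparr>carrier := W\<rparr>)"
proof -
  obtain E where E: "orthonormal E" "finite E" "E \<subseteq> W" "\<And>v. v \<in> W \<Longrightarrow> oproj E v = v"
    using finite_orthonormal_basis_if_compact_ball[OF W assms] by blast
  have "is_finite_basis (vector_module\<lparr>carrier := W\<rparr>) E"
    unfolding is_finite_basis_def lin_comb_subspace[OF E(2,3)]
  proof (intro conjI ballI allI impI)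
    fix v assume "v \<in> carrier (vector_module\<lparr>carrier := W\<rparr>)"
    then have "v = (\<Sum>e\<in>E. e *\<^sub>H qinner e v)"
      using E(4)[of v] by (simp add: oproj_def)
    then show "\<exists>c. v = (\<Sum>e\<in>E. e *\<^sub>H c e)"
      by (rule exI[of _ "\<lambda>e. qinner e v"])
  next
    fix c e assume "(\<Sum>e\<in>E. e *\<^sub>H c e) = \<zero>\<^bsub>vector_module\<lparr>carrier := W\<rparr>\<^esub>" "e \<in> E"
    then show "c e = 0"
      using qinner_orthonormal_sum[OF E(1,2), of e c] by (simp add: vector_module_def)
  qed (use E in auto)
  then show ?thesis
    by (auto simp: finite_dim_def)
qed

end

text \<open>
  The zero vector does not belong to a basis, so the zero space has the empty set as its only basis.
\<close>

lemma qdim_zero_module: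
  assumes "abelian_monoid M" "carrier M = {\<zero>\<^bsub>M\<^esub>}" "1 \<odot>\<^bsub>M\<^esub> \<zero>\<^bsub>M\<^esub> = \<zero>\<^bsub>M\<^esub>"
  shows "qdim M = 0"
proof -
  interpret abelian_monoid M
    by fact
  have "is_finite_basis M S \<longleftrightarrow> S = {}" for S
  proof
    assume S: "is_finite_basis M S"
    show "S = {}"
    proof (rule ccontr)
      assume "S \<noteq> {}"
      then have "S = {\<zero>\<^bsub>M\<^esub>}"
        using S assms(2) by (auto simp: is_finite_basis_def)
      moreover have "lin_comb M (\<lambda>_. 1) {\<zero>\<^bsub>M\<^esub>} = \<zero>\<^bsub>M\<^esub>"
        by (simp add: lin_comb_def assms(3))
      ultimately have "(1 :: quat) = 0"
        using S unfolding is_finite_basis_def by (metis insertI1)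
      then show False
        by simp
    qed
  next
    assume "S = {}"
    then show "is_finite_basis M S"
      using assms(2) by (auto simp: is_finite_basis_def lin_comb_def)
  qed
  then show ?thesis
    by (simp add: qdim_def)
qed


section \<open>Fredholm operators\<close>

lemma right_subspace_kernel: "T \<in> right_linear_ops \<Longrightarrow> right_subspace {x. blinfun_apply T x = 0}"
  by (auto simp: right_subspace_def right_linear_ops_def blinfun.bilinear_simps)

lemma right_subspace_range: "T \<in> right_linear_ops \<Longrightarrow> right_subspace (range (blinfun_apply T))"
  unfolding right_subspace_def right_linear_ops_def
  by (auto simp flip: blinfun.add_right) (metis blinfun.zero_right rangeI, metis rangeI)

text \<open>
  Project onto the span of a finite \<open>1/2\<close>-net of the compact image of the unit ball: the residual of
  a vector is no larger than its distance to a point of the net.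
\<close>

lemma compact_op_finite_rank_approx:
  fixes K :: "'a::right_quaternionic_hilbert \<Rightarrow>\<^sub>L 'a"
  assumes "K \<in> compact_ops"
  obtains E where "finite E" "\<And>x. norm (K x - oproj E (K x)) \<le> norm x / 2"
proof -
  have "compact (closure (K ` cball 0 1))"
    using assms by (simp add: compact_ops_def)
  then obtain Y where Y: "finite Y" "closure (K ` cball 0 1) \<subseteq> (\<Union>y\<in>Y. ball y (1/2))"
    unfolding compact_eq_totally_bounded by (meson half_gt_zero_iff zero_less_one)
  obtain E where E: "orthonormal E" "finite E" and EY: "\<And>y. y \<in> Y \<Longrightarrow> oproj E y = y"
    using finite_set_in_orthonormal_span[OF Y(1)] by blast
  have ball: "norm (K x - oproj E (K x)) \<le> 1/2" if "norm x \<le> 1" for x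
  proof -
    have "K x \<in> closure (K ` cball 0 1)"
      using that by (intro subsetD[OF closure_subset]) auto
    then obtain y where y: "y \<in> Y" "dist y (K x) < 1/2"
      using Y(2) by auto
    have "K x - oproj E (K x) = (K x - y) - oproj E (K x - y)"
      by (simp add: oproj_diff EY y(1))
    also have "norm \<dots> \<le> norm (K x - y)"
      by (rule norm_oproj_residual_le[OF E])
    also have "\<dots> \<le> 1/2"
      using y(2) by (simp add: dist_norm norm_minus_commute)
    finally show ?thesis .
  qed
  have oproj_scaleR: "oproj E (r *\<^sub>R v) = r *\<^sub>R oproj E v" for r v
    by (simp add: oproj_def scaleR_sum_right qinner_scaleH_right scaleH_scaleH flip: scaleH_of_real)
      (simp add: scaleH_sum_left scaleH_scaleH)
  have "norm (K x - oproj E (K x)) \<le> norm x / 2" for x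
  proof (cases "x = 0")
    case True
    then show ?thesis
      by (simp add: oproj_def)
  next
    case False
    let ?u = "x /\<^sub>R norm x"
    have x: "x = norm x *\<^sub>R ?u"
      using False by simp
    have "K x - oproj E (K x) = norm x *\<^sub>R (K ?u - oproj E (K ?u))"
      by (subst (1 2) x) (simp only: blinfun.scaleR_right oproj_scaleR scaleR_diff_right)
    then have "norm (K x - oproj E (K x)) = norm x * norm (K ?u - oproj E (K ?u))"
      by simp
    also have "\<dots> \<le> norm x * (1/2)"
      using False by (intro mult_left_mono ball) auto
    finally show ?thesis
      by simp
  qed
  with E(2) that show ?thesis
    by blast
qed

lemma finite_codim_range_id_plus_compact:
  fixes K :: "'a::right_quaternionic_hilbert \<Rightarrow>\<^sub>L 'a"
  assumes "K \<in> compact_ops"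
  obtains E where "finite E" "\<And>v. \<exists>x c. v - (\<Sum>e\<in>E. e *\<^sub>H c e) = x + K x"
proof -
  obtain E where E: "finite E" "\<And>x. norm (K x - oproj E (K x)) \<le> norm x / 2"
    using compact_op_finite_rank_approx[OF assms] by blast
  have "\<exists>x c. v - (\<Sum>e\<in>E. e *\<^sub>H c e) = x + K x" for v
  proof -
    \<comment> \<open>A fixed point of \<open>f\<close> solves \<open>x + K x - oproj E (K x) = v\<close>.\<close>
    define f where "f x = v - (K x - oproj E (K x))" for x
    have "dist (f x) (f y) \<le> 1/2 * dist x y" for x y
    proof -
      have "f x - f y = K (y - x) - oproj E (K (y - x))"
        by (simp add: f_def blinfun.diff_right oproj_diff)
      then show ?thesis
        using E(2)[of "y - x"] by (simp add: dist_norm norm_minus_commute)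
    qed
    then obtain x where "f x = x"
      using banach_fix_type[of "1/2" f] by auto
    then have "v - (\<Sum>e\<in>E. e *\<^sub>H (- qinner e (K x))) = x + K x"
      by (simp add: f_def oproj_def scaleH_minus_right sum_negf algebra_simps)
    then show ?thesis
      by (intro exI[of _ x] exI[of _ "\<lambda>e. - qinner e (K x)"])
  qed
  with E(1) that show ?thesis
    by blast
qed

text \<open>
  The half of Atkinson's theorem that is needed: a left inverse modulo the compact operators
  controls the kernel, a right inverse the cokernel.
\<close>

lemma fredholm_if_invertible_mod_compact:
  fixes S T :: "'a::right_quaternionic_hilbert \<Rightarrow>\<^sub>L 'a"
  assumes T: "T \<in> right_linear_ops"
    and left: "(S o\<^sub>L T) - id_blinfun \<in> compact_ops"
    and right: "(T o\<^sub>L S) - id_blinfun \<in> compact_ops"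
  shows "T \<in> fredholm"
proof -
  have "finite_dim (ker_module T)"
    unfolding ker_module_def
  proof (rule finite_dim_subspace_if_compact_ball[OF right_subspace_kernel[OF T]])
    let ?L = "(S o\<^sub>L T) - id_blinfun"
    show "compact (closure (?L ` cball 0 1))"
      using left by (simp add: compact_ops_def)
    show "{x. T x = 0} \<inter> cball 0 1 \<subseteq> closure (?L ` cball 0 1)"
    proof
      fix x assume "x \<in> {x. T x = 0} \<inter> cball 0 1"
      then have "x = ?L (- x)" "- x \<in> cball 0 1"
        by (auto simp: blinfun.bilinear_simps)
      then show "x \<in> closure (?L ` cball 0 1)"
        by (metis closure_subset imageI subsetD)
    qed
  qed
  moreover have "finite_dim (coker_module T)"
  proof -
    let ?K = "(T o\<^sub>L S) - id_blinfun"
    obtain E where E: "finite E" "\<And>v. \<exists>x c. v - (\<Sum>e\<in>E. e *\<^sub>H c e) = x + ?K x"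
      using finite_codim_range_id_plus_compact[OF right] by blast
    have span: "\<exists>c. v - (\<Sum>e\<in>E. e *\<^sub>H c e) \<in> range T" for v
    proof -
      obtain x c where "v - (\<Sum>e\<in>E. e *\<^sub>H c e) = x + ?K x"
        using E(2) by blast
      then have "v - (\<Sum>e\<in>E. e *\<^sub>H c e) = T (S x)"
        by (simp add: blinfun.bilinear_simps)
      then show ?thesis
        by blast
    qed
    show ?thesis
      unfolding coker_module_def
      by (rule finite_dim_quotient_if_finite_span[OF right_subspace_range[OF T] E(1) span])
  qed
  ultimately show ?thesis
    using T by (simp add: fredholm_def)
qed

text \<open>
  In the cokernel, the range is the whole space, so that all cosets coincide with the zero coset.
\<close>

lemma fredholm_index_bij:
  fixes T :: "'a::right_quaternionic_hilbert \<Rightarrow>\<^sub>L 'a"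
  assumes T: "T \<in> right_linear_ops" and bij: "bij (blinfun_apply T)"
  shows "fredholm_index T = 0"
proof -
  have ker: "{x. T x = 0} = {0}"
    using bij by (auto simp: bij_def dest: injD[of _ _ 0])
  have "qdim (ker_module T) = 0"
  proof (rule qdim_zero_module)
    show "abelian_monoid (ker_module T)"
      unfolding ker_module_def by (intro abelian_monoid_subspace right_subspace_kernel T)
  qed (simp_all add: ker_module_def ker vector_module_def)
  moreover have "qdim (coker_module T) = 0"
  proof -
    have ran: "range T = UNIV"
      using bij by (simp add: bij_def)
    have U: "right_subspace (UNIV :: 'a set)"
      by (simp add: right_subspace_def)
    have coset: "UNIV +>\<^bsub>vector_module\<^esub> x = UNIV" for x :: 'a
      using vcoset_eq_iff[OF U, of x 0] vcoset_zero[OF U] by simp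
    show ?thesis
      unfolding coker_module_def ran
    proof (rule qdim_zero_module)
      show "abelian_monoid (FactModule vector_module (UNIV :: 'a set))"
        by (rule abelian_monoid_FactModule[OF U])
    qed (use FactModule_vector_module_simps(4)[OF U, of 1 0]
        in \<open>simp_all add: FactModule_vector_module_simps[OF U] coset\<close>)
  qed
  ultimately show ?thesis
    by (simp add: fredholm_index_def)
qed


section \<open>Invertibility in the operator algebra and in the Calkin algebra\<close>

lemma Units_bounded_op_algebra_bij:
  assumes "T \<in> Units bounded_op_algebra"
  shows "bij (blinfun_apply T)"
proof -
  obtain S where "S o\<^sub>L T = id_blinfun" "T o\<^sub>L S = id_blinfun"
    using assms by (auto simp: Units_def bounded_op_algebra_def)
  then have "S (T x) = x" "T (S x) = x" for x
    by (metis blinfun_apply_blinfun_compose blinfun_apply_id_blinfun id_apply)+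
  then show ?thesis
    by (intro bij_betw_byWitness[of _ S]) auto
qed

lemma compact_ops_closed:
  fixes S T :: "'a::right_quaternionic_hilbert \<Rightarrow>\<^sub>L 'a"
  shows "(0 :: 'a \<Rightarrow>\<^sub>L 'a) \<in> compact_ops"
    and "S \<in> compact_ops \<Longrightarrow> T \<in> compact_ops \<Longrightarrow> S + T \<in> compact_ops"
    and "T \<in> compact_ops \<Longrightarrow> r *\<^sub>R T \<in> compact_ops"
    and "T \<in> compact_ops \<Longrightarrow> - T \<in> compact_ops"
proof -
  interpret ideal compact_ops "bounded_op_algebra :: (real, 'a \<Rightarrow>\<^sub>L 'a) module"
    by (rule ideal_compact_ops)
  show "(0 :: 'a \<Rightarrow>\<^sub>L 'a) \<in> compact_ops"
    using additive_subgroup.zero_closed[OF additive_subgroup_axioms]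
    by (simp add: bounded_op_algebra_def)
  show "S + T \<in> compact_ops" if "S \<in> compact_ops" "T \<in> compact_ops"
    using additive_subgroup.a_closed[OF additive_subgroup_axioms that]
    by (simp add: bounded_op_algebra_def)
  show scale: "r *\<^sub>R T \<in> compact_ops" if "T \<in> compact_ops" for r and T :: "'a \<Rightarrow>\<^sub>L 'a"
  proof -
    have "(r *\<^sub>R id_blinfun) o\<^sub>L T \<in> compact_ops"
      using I_l_closed[OF that, of "r *\<^sub>R id_blinfun"] by (simp add: bounded_op_algebra_def)
    also have "(r *\<^sub>R id_blinfun) o\<^sub>L T = r *\<^sub>R T"
      by (rule blinfun_eqI) (simp add: blinfun.scaleR_left)
    finally show ?thesis .
  qed
  show "- T \<in> compact_ops" if "T \<in> compact_ops"
    using scale[OF that, of "- 1"] by simp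
qed

lemma calkin_proj_eq_iff: "calkin_proj S = calkin_proj T \<longleftrightarrow> S - T \<in> compact_ops"
  unfolding calkin_proj_def
  by (rule coset_eq_iff) (auto simp: bounded_op_algebra_def compact_ops_closed)

lemma ring_hom_calkin_proj:
  "calkin_proj \<in> ring_hom (bounded_op_algebra :: (real, 'a::right_quaternionic_hilbert \<Rightarrow>\<^sub>L 'a) module)
    calkin_algebra"
  using ideal.rcos_ring_hom[OF ideal_compact_ops]
  by (simp add: ring_hom_def calkin_algebra_def calkin_proj_def FactModule_def ring.defs module.defs
      Pi_def)

text \<open>
  The Calkin algebra is the quotient ring with a scalar multiplication added as a record field, so
  the ring axioms carry over field by field.
\<close>

lemma ring_calkin_algebra:
  "ring (calkin_algebra :: (real, ('a::right_quaternionic_hilbert \<Rightarrow>\<^sub>L 'a) set) module)"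
proof -
  let ?Q = "(bounded_op_algebra :: (real, 'a \<Rightarrow>\<^sub>L 'a) module) Quot compact_ops"
  interpret Q: ring ?Q
    by (rule ideal.quotient_is_ring[OF ideal_compact_ops])
  have "carrier calkin_algebra = carrier ?Q" "mult calkin_algebra = mult ?Q"
    "one calkin_algebra = one ?Q" "zero calkin_algebra = zero ?Q" "add calkin_algebra = add ?Q"
    by (simp_all add: calkin_algebra_def FactModule_def ring.defs module.defs)
  note eqs = this
  show ?thesis
  proof (intro ringI abelian_groupI Group.monoidI; unfold eqs)
    fix x assume "x \<in> carrier ?Q"
    then show "\<exists>y\<in>carrier ?Q. y \<oplus>\<^bsub>?Q\<^esub> x = \<zero>\<^bsub>?Q\<^esub>"
      by (intro bexI[of _ "\<ominus>\<^bsub>?Q\<^esub> x"]) (simp_all add: Q.l_neg)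
  qed (simp_all add: Q.a_ac Q.m_assoc Q.l_distr Q.r_distr)
qed

lemma smult_calkin_algebra: "r \<odot>\<^bsub>calkin_algebra\<^esub> calkin_proj T = calkin_proj (r *\<^sub>R T)"
proof -
  have "r \<odot>\<^bsub>calkin_algebra\<^esub> calkin_proj T = calkin_proj (r \<odot>\<^bsub>bounded_op_algebra\<^esub> T)"
    unfolding calkin_algebra_def calkin_proj_def
    by (rule FactModule_smult_coset)
      (auto simp: bounded_op_algebra_def compact_ops_closed scaleR_add_right)
  then show ?thesis
    by (simp add: bounded_op_algebra_def)
qed

lemma R_poly_calkin_proj:
  fixes A :: "'a::right_quaternionic_hilbert \<Rightarrow>\<^sub>L 'a"
  assumes "A \<in> right_linear_ops"
  shows "R_poly calkin_algebra q (calkin_proj A) = calkin_proj (R_poly bounded_op_algebra q A)"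
proof -
  interpret ring_hom_ring "bounded_op_algebra :: (real, 'a \<Rightarrow>\<^sub>L 'a) module" calkin_algebra calkin_proj
    by (intro ring_hom_ringI2 ring_bounded_op_algebra ring_calkin_algebra ring_hom_calkin_proj)
  have smult: "r \<odot>\<^bsub>bounded_op_algebra\<^esub> T = r *\<^sub>R T"
    and one: "\<one>\<^bsub>bounded_op_algebra\<^esub> = id_blinfun"
    and scaleR_closed: "T \<in> right_linear_ops \<Longrightarrow> r *\<^sub>R T \<in> carrier bounded_op_algebra"
    and closed: "A \<in> carrier bounded_op_algebra" for T :: "'a \<Rightarrow>\<^sub>L 'a" and r
    using assms by (simp_all add: bounded_op_algebra_def)
  have one_calkin: "\<one>\<^bsub>calkin_algebra\<^esub> = calkin_proj (id_blinfun :: 'a \<Rightarrow>\<^sub>L 'a)"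
    using hom_one by (simp add: one)
  show ?thesis
    unfolding R_poly_def smult one one_calkin smult_calkin_algebra
    using closed assms by (simp add: a_minus_def scaleR_closed)
qed

lemma R_poly_closed:
  fixes A :: "'a::right_quaternionic_hilbert \<Rightarrow>\<^sub>L 'a"
  assumes "A \<in> right_linear_ops"
  shows "R_poly bounded_op_algebra q A \<in> right_linear_ops"
proof -
  interpret ring "bounded_op_algebra :: (real, 'a \<Rightarrow>\<^sub>L 'a) module"
    by (rule ring_bounded_op_algebra)
  have carrier: "carrier bounded_op_algebra = (right_linear_ops :: ('a \<Rightarrow>\<^sub>L 'a) set)"
    and smult: "r \<odot>\<^bsub>bounded_op_algebra\<^esub> T = r *\<^sub>R T" for T :: "'a \<Rightarrow>\<^sub>L 'a" and r
    by (simp_all add: bounded_op_algebra_def)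
  have "R_poly bounded_op_algebra q A \<in> carrier bounded_op_algebra"
    unfolding R_poly_def smult
    using assms one_closed by (intro add.m_closed minus_closed m_closed) (auto simp: carrier)
  then show ?thesis
    by (simp add: carrier)
qed

lemma calkin_proj_Units:
  assumes "T \<in> Units bounded_op_algebra"
  shows "calkin_proj T \<in> Units calkin_algebra"
proof -
  obtain S where S: "T \<in> carrier bounded_op_algebra" "S \<in> carrier bounded_op_algebra"
    "S \<otimes>\<^bsub>bounded_op_algebra\<^esub> T = \<one>\<^bsub>bounded_op_algebra\<^esub>"
    "T \<otimes>\<^bsub>bounded_op_algebra\<^esub> S = \<one>\<^bsub>bounded_op_algebra\<^esub>"
    using assms by (auto simp: Units_def)
  note hom = ring_hom_closed[OF ring_hom_calkin_proj] ring_hom_mult[OF ring_hom_calkin_proj]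
    ring_hom_one[OF ring_hom_calkin_proj]
  show ?thesis
    unfolding Units_def using S hom by (smt (verit) mem_Collect_eq)
qed

lemma fredholm_if_calkin_proj_Units:
  assumes T: "T \<in> right_linear_ops" and unit: "calkin_proj T \<in> Units calkin_algebra"
  shows "T \<in> fredholm"
proof -
  have carrier: "carrier bounded_op_algebra = (right_linear_ops :: ('a \<Rightarrow>\<^sub>L 'a) set)"
    by (simp add: bounded_op_algebra_def)
  obtain Y where Y: "Y \<in> carrier calkin_algebra" "Y \<otimes>\<^bsub>calkin_algebra\<^esub> calkin_proj T = \<one>\<^bsub>calkin_algebra\<^esub>"
    "calkin_proj T \<otimes>\<^bsub>calkin_algebra\<^esub> Y = \<one>\<^bsub>calkin_algebra\<^esub>"
    using unit by (auto simp: Units_def)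
  obtain S where S: "S \<in> right_linear_ops" "Y = calkin_proj S"
    using Y(1) by (auto simp: calkin_algebra_def calkin_proj_def FactModule_def ring.defs module.defs
        FactRing_def A_RCOSETS_def' bounded_op_algebra_def a_r_coset_def')
  have one: "calkin_proj id_blinfun = \<one>\<^bsub>calkin_algebra\<^esub>"
    using ring_hom_one[OF ring_hom_calkin_proj] by (simp add: bounded_op_algebra_def)
  have mult: "calkin_proj (P o\<^sub>L Q) = calkin_proj P \<otimes>\<^bsub>calkin_algebra\<^esub> calkin_proj Q"
    if "P \<in> right_linear_ops" "Q \<in> right_linear_ops" for P Q :: "'a \<Rightarrow>\<^sub>L 'a"
    using ring_hom_mult[OF ring_hom_calkin_proj, of P Q] that by (simp add: bounded_op_algebra_def)
  show ?thesis
  proof (rule fredholm_if_invertible_mod_compact[OF T])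
    show "(S o\<^sub>L T) - id_blinfun \<in> compact_ops" "(T o\<^sub>L S) - id_blinfun \<in> compact_ops"
      using Y(2,3) S T by (auto simp: mult one simp flip: calkin_proj_eq_iff)
  qed
qed

theorem proposition7p18:
  fixes A :: "'a::right_quaternionic_hilbert \<Rightarrow>\<^sub>L 'a"
  assumes "separable_space (euclidean :: 'a topology)"
    and "A \<in> right_linear_ops"
  shows "S_spectrum bounded_op_algebra A
    = essential_S_spectrum A \<union> (\<Union>k::int. S_spectrum_part k A)"
proof (intro equalityI subsetI)
  fix q assume q: "q \<in> S_spectrum bounded_op_algebra A"
  let ?T = "R_poly bounded_op_algebra q A"
  show "q \<in> essential_S_spectrum A \<union> (\<Union>k::int. S_spectrum_part k A)"
  proof (cases "q \<in> essential_S_spectrum A")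
    case False
    then have "calkin_proj ?T \<in> Units calkin_algebra"
      by (simp add: essential_S_spectrum_def S_spectrum_def R_poly_calkin_proj[OF assms(2)])
    then have "?T \<in> fredholm"
      by (intro fredholm_if_calkin_proj_Units R_poly_closed assms(2))
    then have "q \<in> S_spectrum_part (fredholm_index ?T) A"
      using q by (simp add: S_spectrum_part_def)
    then show ?thesis
      by blast
  qed simp
next
  fix q assume q: "q \<in> essential_S_spectrum A \<union> (\<Union>k::int. S_spectrum_part k A)"
  let ?T = "R_poly bounded_op_algebra q A"
  show "q \<in> S_spectrum bounded_op_algebra A"
  proof (rule ccontr)
    assume n: "q \<notin> S_spectrum bounded_op_algebra A"
    then have unit: "?T \<in> Units bounded_op_algebra"
      by (simp add: S_spectrum_def)
    then have "q \<notin> essential_S_spectrum A"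
      using calkin_proj_Units
      by (simp add: essential_S_spectrum_def S_spectrum_def R_poly_calkin_proj[OF assms(2)])
    moreover have "fredholm_index ?T = 0"
      by (intro fredholm_index_bij R_poly_closed assms(2) Units_bounded_op_algebra_bij unit)
    ultimately show False
      using q n by (auto simp: S_spectrum_part_def split: if_splits)
  qed
qed

end
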